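(* Let $\lambda=(\lambda_1,\ldots,\lambda_n)$ be a wide partition with $n$ parts, and let $m=\lambda_1$. Let $\mu$ be the partition with $2m+n$ parts $$\mu=(2m+\lambda'_1,\ldots,2m+\lambda'_m,\underbrace{2m,\ldots,2m}_{m\text{ times}},\lambda_1,\ldots,\lambda_n),$$ i.e. the Young diagram of $\mu$ is a $2m\times 2m$ square with the diagram of $\lambda$ attached below it and the diagram of $\lambda'$ attached to its right. Then $\mu$ is a wide partition.
   Context: For partitions $\alpha,\beta$ of the same integer, $\alpha\ge\beta$ (dominance) means $\sum_{k\le j}\alpha_k\ge\sum_{k\le j}\beta_k$ for all $j$; $\mu'$ is the conjugate of $\mu$ (so $\lambda'$ has exactly $\lambda_1=m$ parts). $\nu$ is a subpartition of $\lambda$ if the multiset of parts of $\nu$ is a submultiset of that of $\lambda$. $\lambda$ is wide if $\nu\ge\nu'$ for every subpartition $\nu$ of $\lambda$. *)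

theory Defs
  imports "HOL-Library.Multiset"
begin

text \<open>A partition is the weakly decreasing list of its (positive) parts.\<close>

definition is_partition :: "nat list \<Rightarrow> bool" where
  "is_partition \<alpha> \<longleftrightarrow> sorted_wrt (\<ge>) \<alpha> \<and> (\<forall>x \<in> set \<alpha>. x > 0)"

text \<open>Parts are indexed from 1, and \<open>part \<alpha> k = 0\<close> beyond the last part; in particular
  the first part of the empty partition is 0.\<close>

definition part :: "nat list \<Rightarrow> nat \<Rightarrow> nat" where
  "part \<alpha> k = (if 1 \<le> k \<and> k \<le> length \<alpha> then \<alpha> ! (k - 1) else 0)"

definition conjugate :: "nat list \<Rightarrow> nat list" where
  "conjugate \<alpha> = map (\<lambda>j. card {i \<in> {1..length \<alpha>}. part \<alpha> i \<ge> j}) [1..<part \<alpha> 1 + 1]"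

definition dominates :: "nat list \<Rightarrow> nat list \<Rightarrow> bool" where
  "dominates \<alpha> \<beta> \<longleftrightarrow> sum_list \<alpha> = sum_list \<beta> \<and>
     (\<forall>j. (\<Sum>k=1..j. part \<alpha> k) \<ge> (\<Sum>k=1..j. part \<beta> k))"

definition subpartition :: "nat list \<Rightarrow> nat list \<Rightarrow> bool" where
  "subpartition \<nu> \<alpha> \<longleftrightarrow> is_partition \<nu> \<and> mset \<nu> \<subseteq># mset \<alpha>"

definition wide :: "nat list \<Rightarrow> bool" where
  "wide \<alpha> \<longleftrightarrow> is_partition \<alpha> \<and> (\<forall>\<nu>. subpartition \<nu> \<alpha> \<longrightarrow> dominates \<nu> (conjugate \<nu>))"

end

theory Submission
  imports Defs "HOL-Library.Sublist"
begin

text \<open>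
  Since \<open>\<Sum>\<^sub>k\<^sub>\<le>\<^sub>j \<nu>'\<^sub>k = \<Sum>\<^sub>i min \<nu>\<^sub>i j\<close>, the inequality \<open>\<nu> \<ge> \<nu>'\<close> at index \<open>j\<close> says that the
  cells of \<open>\<nu>\<close> in the first \<open>j\<close> rows and outside the first \<open>j\<close> columns are at least as
  many as those below the first \<open>j\<close> rows and inside the first \<open>j\<close> columns. The worst
  subpartitions are those obtained by deleting the first \<open>s\<close> rows, so wideness is a family of
  inequalities indexed by \<open>(s, j)\<close>. For \<open>\<mu>\<close>, each of them follows from the inequality of
  \<open>\<lambda>\<close> for a suitable pair after comparing \<open>s\<close>, \<open>j\<close> and \<open>s + j\<close> with \<open>m\<close> and \<open>2m\<close>;
  the cells of the \<open>2m \<times> 2m\<close> square pay for the rows of \<open>\<lambda>\<close> that this pair does not cover.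
\<close>

definition row :: "nat list \<Rightarrow> nat \<Rightarrow> nat" where
  "row \<alpha> k = part \<alpha> (Suc k)"

text \<open>Rows are indexed from 0 and padded with zeros. The arbitrary bound \<open>N\<close>
  replaces an infinite sum over the lower rows, and truncated subtraction makes
  \<open>L k - j\<close> the number of cells of row \<open>k\<close> outside the first
  \<open>j\<close> columns.\<close>

definition wide_seq :: "(nat \<Rightarrow> nat) \<Rightarrow> bool" where
  "wide_seq L \<longleftrightarrow> antimono L \<and>
     (\<forall>s j N. (\<Sum>k\<in>{s + j..<N}. min (L k) j) \<le> (\<Sum>k\<in>{s..<s + j}. L k - j))"

section \<open>Wideness in terms of row lengths\<close>

lemma row_eq: "row \<alpha> k = (if k < length \<alpha> then \<alpha> ! k else 0)"
  by (auto simp: row_def part_def)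

lemma row_drop: "row (drop s \<alpha>) k = row \<alpha> (s + k)"
  by (auto simp: row_eq)

lemma antimono_row:
  assumes "is_partition \<alpha>"
  shows "antimono (row \<alpha>)"
proof (rule antimonoI)
  fix x y :: nat assume "x \<le> y"
  then show "row \<alpha> y \<le> row \<alpha> x"
    using assms by (cases "x = y") (auto simp: row_eq is_partition_def sorted_wrt_iff_nth_less)
qed

text \<open>Double counting of the pairs \<open>(k, r)\<close> with \<open>k < f r\<close>: for row
  lengths \<open>f\<close>, the cells in columns \<open>s\<close> to \<open>t - 1\<close> are
  counted by columns and by rows.\<close>

lemma sum_card_levels:
  fixes f :: "'a \<Rightarrow> nat"
  assumes "finite A"
  shows "(\<Sum>k\<in>{s..<t}. card {r\<in>A. k < f r}) = (\<Sum>r\<in>A. min (f r) t - s)"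
proof -
  have "(\<Sum>k\<in>{s..<t}. card {r\<in>A. k < f r}) = (\<Sum>r\<in>A. card {k\<in>{s..<t}. k < f r})"
    using sum_multicount_gen[of "{s..<t}" A "\<lambda>k r. k < f r" "\<lambda>r. card {k\<in>{s..<t}. k < f r}"] assms
    by auto
  moreover have "{k\<in>{s..<t}. k < f r} = {s..<min (f r) t}" for r by auto
  ultimately show ?thesis by simp
qed

lemma row_conjugate:
  assumes "is_partition \<alpha>"
  shows "row (conjugate \<alpha>) k = card {r\<in>{..<length \<alpha>}. k < row \<alpha> r}"
proof -
  have im: "{i \<in> {1..length \<alpha>}. Suc k \<le> part \<alpha> i} = Suc ` {r\<in>{..<length \<alpha>}. k < row \<alpha> r}"
    (is "?S = Suc ` ?T")
  proof
    show "?S \<subseteq> Suc ` ?T"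
    proof
      fix i assume "i \<in> ?S"
      then have "i = Suc (i - 1)" "i - 1 \<in> ?T" by (auto simp: row_def)
      then show "i \<in> Suc ` ?T" by blast
    qed
  qed (auto simp: row_def)
  have c: "card ?S = card ?T" unfolding im by (rule card_image) auto
  have first: "part \<alpha> (Suc 0) = row \<alpha> 0" by (simp add: row_def)
  have conj: "row (conjugate \<alpha>) k = (if k < row \<alpha> 0 then card ?S else 0)"
    by (subst row_eq) (simp add: conjugate_def first del: upt_Suc)
  show ?thesis
  proof (cases "k < row \<alpha> 0")
    case True
    then show ?thesis using c conj by simp
  next
    case False
    \<comment> \<open>Past its last part the conjugate reads as 0, and the counted set is empty as
      well.\<close>
    have "row \<alpha> r \<le> row \<alpha> 0" for r using antimono_row[OF assms] by (simp add: antimono_def)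
    then have "?T = {}" using False by (force simp: not_less dest: le_trans)
    then show ?thesis using False conj by simp
  qed
qed

lemma sum_row_conjugate:
  assumes "is_partition \<alpha>"
  shows "(\<Sum>k<j. row (conjugate \<alpha>) k) = (\<Sum>r<length \<alpha>. min (row \<alpha> r) j)"
  using sum_card_levels[where A = "{..<length \<alpha>}" and s = 0 and t = j and f = "row \<alpha>"]
  by (simp add: row_conjugate[OF assms] lessThan_atLeast0)

lemma sum_list_row: "sum_list \<alpha> = (\<Sum>k<length \<alpha>. row \<alpha> k)"
  by (simp add: sum_list_sum_nth row_eq lessThan_atLeast0)

lemma dominates_conjugate_iff:
  assumes "is_partition \<alpha>"
  shows "dominates \<alpha> (conjugate \<alpha>) \<longleftrightarrow>
    (\<forall>j. (\<Sum>r<length \<alpha>. min (row \<alpha> r) j) \<le> (\<Sum>k<j. row \<alpha> k))"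
proof -
  have shift: "(\<Sum>k=1..j. part \<beta> k) = (\<Sum>k<j. row \<beta> k)" for j \<beta>
    by (simp add: row_def sum.atLeast1_atMost_eq)
  have len: "length (conjugate \<alpha>) = row \<alpha> 0" by (simp add: conjugate_def row_def)
  have "row \<alpha> r \<le> row \<alpha> 0" for r using antimono_row[OF assms] by (simp add: antimono_def)
  then have "sum_list \<alpha> = sum_list (conjugate \<alpha>)"
    unfolding sum_list_row len sum_row_conjugate[OF assms] by (intro sum.cong) (auto simp: min_absorb1)
  then show ?thesis
    unfolding dominates_def shift sum_row_conjugate[OF assms] by simp
qed

section \<open>Subpartitions as subsequences\<close>

lemma subseq_of_mset_subset:
  fixes xs ys :: "'a::linorder list"
  assumes "sorted_wrt (\<ge>) xs" "sorted_wrt (\<ge>) ys" "mset xs \<subseteq># mset ys"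
  shows "subseq xs ys"
  using assms
proof (induction ys arbitrary: xs)
  case Nil
  then show ?case by simp
next
  case (Cons y ys)
  show ?case
  proof (cases xs)
    case Nil
    then show ?thesis by simp
  next
    case xs: (Cons x xs')
    show ?thesis
    proof (cases "x = y")
      case True
      then show ?thesis using Cons xs by simp
    next
      case False
      \<comment> \<open>Both lists decrease, so a head \<open>y\<close> that differs from
        \<open>x\<close> exceeds every entry of \<open>xs\<close> and can be skipped.\<close>
      have "set xs \<subseteq> set (y # ys)" using Cons.prems(3) by (metis set_mset_mono set_mset_mset)
      then have "x < y" using False xs Cons.prems(2) by auto
      then have "y \<notin> set xs" using xs Cons.prems(1) by auto
      then have "mset xs \<subseteq># mset ys"
        using Cons.prems(3) by (auto simp: subseteq_mset_def count_mset_0_iff split: if_splits)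
           (metis count_mset_0_iff le0)
      then show ?thesis using Cons by auto
    qed
  qed
qed

text \<open>Making \<open>e\<close> strictly increasing on all of \<open>nat\<close>, not only on
  the indices of \<open>xs\<close>, lets \<open>strict_mono_add_le\<close> apply without range
  conditions.\<close>

lemma subseq_index_embedding:
  assumes "subseq xs ys"
  obtains e :: "nat \<Rightarrow> nat" where "strict_mono e"
    and "\<And>i. i < length xs \<Longrightarrow> e i < length ys \<and> xs ! i = ys ! e i"
proof -
  from assms have "\<exists>e::nat \<Rightarrow> nat. strict_mono e \<and> (\<forall>i<length xs. e i < length ys \<and> xs ! i = ys ! e i)"
  proof (induction rule: list_emb.induct)
    case (list_emb_Nil ys)
    then show ?case by (auto intro!: exI[of _ id] simp: strict_mono_def)
  next
    case (list_emb_Cons xs ys y)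
    then obtain e :: "nat \<Rightarrow> nat" where "strict_mono e" "\<forall>i<length xs. e i < length ys \<and> xs ! i = ys ! e i"
      by blast
    then show ?case by (intro exI[of _ "Suc \<circ> e"]) (auto simp: strict_mono_def)
  next
    case (list_emb_Cons2 x y xs ys)
    then obtain e :: "nat \<Rightarrow> nat" where "strict_mono e" "\<forall>i<length xs. e i < length ys \<and> xs ! i = ys ! e i"
      by blast
    then show ?case using list_emb_Cons2.hyps
      by (intro exI[of _ "case_nat 0 (Suc \<circ> e)"])
         (auto simp: strict_mono_def nth_Cons less_Suc_eq_0_disj split: nat.splits)
  qed
  then show thesis using that by blast
qed

lemma strict_mono_add_le:
  fixes e :: "nat \<Rightarrow> nat"
  assumes "strict_mono e"
  shows "e i + d \<le> e (i + d)"
proof (induction d)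
  case (Suc d)
  then show ?case using strict_monoD[OF assms, of "i + d" "i + Suc d"] by simp
qed simp

section \<open>Equivalence of wideness and the row inequalities\<close>

lemma wide_seq_row_if_wide:
  assumes "wide \<alpha>"
  shows "wide_seq (row \<alpha>)"
  unfolding wide_seq_def
proof (intro conjI allI)
  have part: "is_partition \<alpha>" using assms by (simp add: wide_def)
  then show "antimono (row \<alpha>)" by (rule antimono_row)
  fix s j N
  define \<nu> where "\<nu> = drop s \<alpha>"
  have p\<nu>: "is_partition \<nu>"
    using part by (auto simp: is_partition_def \<nu>_def sorted_wrt_drop dest: in_set_dropD)
  have "mset \<nu> \<subseteq># mset \<alpha>"
    unfolding \<nu>_def by (metis append_take_drop_id mset_append mset_subset_eq_add_right)
  then have "dominates \<nu> (conjugate \<nu>)"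
    using assms p\<nu> by (auto simp: wide_def subpartition_def)
  then have dom: "(\<Sum>r<length \<nu>. min (row \<nu> r) j) \<le> (\<Sum>k<j. row \<nu> k)"
    using dominates_conjugate_iff[OF p\<nu>] by blast
  define K where "K = max N j + length \<nu>"
  have "(\<Sum>r\<in>{0..<K}. min (row \<nu> r) j) = (\<Sum>r<length \<nu>. min (row \<nu> r) j)"
    by (rule sum.mono_neutral_right) (auto simp: K_def row_eq)
  moreover have "(\<Sum>r\<in>{0..<K}. min (row \<nu> r) j)
      = (\<Sum>r\<in>{0..<j}. min (row \<nu> r) j) + (\<Sum>r\<in>{j..<K}. min (row \<nu> r) j)"
    by (rule sum.atLeastLessThan_concat[symmetric]) (auto simp: K_def)
  \<comment> \<open>The cells in the first \<open>j\<close> rows and first \<open>j\<close> columns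
    occur on both sides of the dominance inequality and cancel.\<close>
  moreover have "(\<Sum>k<j. row \<nu> k) = (\<Sum>r\<in>{0..<j}. min (row \<nu> r) j) + (\<Sum>k\<in>{0..<j}. row \<nu> k - j)"
    by (auto simp: sum.distrib[symmetric] lessThan_atLeast0 intro!: sum.cong)
  ultimately have main: "(\<Sum>r\<in>{j..<K}. min (row \<nu> r) j) \<le> (\<Sum>k\<in>{0..<j}. row \<nu> k - j)"
    using dom by linarith
  have "(\<Sum>k\<in>{s + j..<N}. min (row \<alpha> k) j) \<le> (\<Sum>k\<in>{j + s..<K + s}. min (row \<alpha> k) j)"
    by (rule sum_mono2) (auto simp: K_def)
  also have "\<dots> = (\<Sum>r\<in>{j..<K}. min (row \<nu> r) j)"
    by (subst sum.shift_bounds_nat_ivl) (simp add: \<nu>_def row_drop add.commute)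
  also note main
  also have "(\<Sum>k\<in>{0..<j}. row \<nu> k - j) = (\<Sum>k\<in>{0 + s..<j + s}. row \<alpha> k - j)"
    by (subst sum.shift_bounds_nat_ivl) (simp add: \<nu>_def row_drop add.commute)
  finally show "(\<Sum>k\<in>{s + j..<N}. min (row \<alpha> k) j) \<le> (\<Sum>k\<in>{s..<s + j}. row \<alpha> k - j)"
    by (simp add: add.commute)
qed

lemma wide_if_wide_seq_row:
  assumes part: "is_partition \<alpha>" and seq: "wide_seq (row \<alpha>)"
  shows "wide \<alpha>"
  unfolding wide_def
proof (intro conjI allI impI part)
  fix \<nu> assume sub: "subpartition \<nu> \<alpha>"
  then have p\<nu>: "is_partition \<nu>" by (simp add: subpartition_def)
  have "subseq \<nu> \<alpha>"
    using sub part subseq_of_mset_subset by (auto simp: subpartition_def is_partition_def)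
  then obtain e :: "nat \<Rightarrow> nat" where e: "strict_mono e"
    and e_nth: "\<And>i. i < length \<nu> \<Longrightarrow> e i < length \<alpha> \<and> \<nu> ! i = \<alpha> ! e i"
    using subseq_index_embedding by blast
  have row_e: "row \<nu> i = row \<alpha> (e i)" if "i < length \<nu>" for i
    using e_nth[OF that] that by (simp add: row_eq)
  have "(\<Sum>r<length \<nu>. min (row \<nu> r) j) \<le> (\<Sum>k<j. row \<nu> k)" for j
  proof (cases "j < length \<nu>")
    case False
    have "(\<Sum>r<length \<nu>. min (row \<nu> r) j) \<le> (\<Sum>r<length \<nu>. row \<nu> r)"
      by (rule sum_mono) simp
    also have "\<dots> \<le> (\<Sum>k<j. row \<nu> k)"
      using False by (intro sum_mono2) auto
    finally show ?thesis .
  next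
    case j: True
    show ?thesis
    proof (cases j)
      case 0
      then show ?thesis by simp
    next
      case (Suc i0)
      \<comment> \<open>Replace the first \<open>j\<close> rows of \<open>\<nu>\<close> by the \<open>j\<close> consecutive rows of \<open>\<alpha>\<close> that end at the
        same place, and the other rows by all later rows of \<open>\<alpha>\<close>.\<close>
      define s where "s = e i0 - i0"
      have s: "s + i0 = e i0"
        using strict_mono_add_le[OF e, of 0 i0] by (simp add: s_def)
      \<comment> \<open>The indices \<open>e i\<close> and \<open>e i0\<close> differ by at least
        \<open>i0 - i\<close>, so row \<open>i + s\<close> of \<open>\<alpha>\<close> comes no
        earlier than row \<open>e i\<close>.\<close>
      have upper: "row \<alpha> (i + s) \<le> row \<nu> i" if "i < j" for i
      proof -
        have "e i + (i0 - i) \<le> e i0"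
          using strict_mono_add_le[OF e, of i "i0 - i"] that Suc by simp
        then have "e i \<le> i + s" using s that Suc by linarith
        then have "row \<alpha> (i + s) \<le> row \<alpha> (e i)"
          using antimono_row[OF part] by (simp add: antimono_def)
        then show ?thesis using row_e that j by simp
      qed
      have inj: "inj_on e {j..<length \<nu>}"
        using e by (meson inj_on_subset strict_mono_imp_inj_on subset_UNIV)
      have "(\<Sum>r\<in>{j..<length \<nu>}. min (row \<nu> r) j) = (\<Sum>r\<in>{j..<length \<nu>}. min (row \<alpha> (e r)) j)"
        by (rule sum.cong) (auto simp: row_e)
      also have "\<dots> = (\<Sum>k\<in>e ` {j..<length \<nu>}. min (row \<alpha> k) j)"
        by (simp add: sum.reindex[OF inj])
      also have "\<dots> \<le> (\<Sum>k\<in>{s + j..<length \<alpha>}. min (row \<alpha> k) j)"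
      proof (rule sum_mono2)
        show "e ` {j..<length \<nu>} \<subseteq> {s + j..<length \<alpha>}"
        proof (clarsimp simp: e_nth)
          fix r assume "j \<le> r" "r < length \<nu>"
          then have "e i0 < e r" using e Suc by (simp add: strict_mono_def)
          then show "s + j \<le> e r" using s Suc by simp
        qed
      qed auto
      also have "\<dots> \<le> (\<Sum>k\<in>{s..<s + j}. row \<alpha> k - j)"
        using seq by (simp add: wide_seq_def)
      also have "\<dots> = (\<Sum>k\<in>{0 + s..<j + s}. row \<alpha> k - j)" by (simp add: add.commute)
      also have "\<dots> \<le> (\<Sum>k\<in>{0..<j}. row \<nu> k - j)"
        unfolding sum.shift_bounds_nat_ivl by (intro sum_mono diff_le_mono) (simp add: upper)
      finally have main: "(\<Sum>r\<in>{j..<length \<nu>}. min (row \<nu> r) j) \<le> (\<Sum>k\<in>{0..<j}. row \<nu> k - j)" .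
      have "(\<Sum>r<length \<nu>. min (row \<nu> r) j)
          = (\<Sum>r\<in>{0..<j}. min (row \<nu> r) j) + (\<Sum>r\<in>{j..<length \<nu>}. min (row \<nu> r) j)"
        unfolding lessThan_atLeast0 using j by (intro sum.atLeastLessThan_concat[symmetric]) auto
      moreover have "(\<Sum>k<j. row \<nu> k)
          = (\<Sum>r\<in>{0..<j}. min (row \<nu> r) j) + (\<Sum>k\<in>{0..<j}. row \<nu> k - j)"
        by (auto simp: sum.distrib[symmetric] lessThan_atLeast0 intro!: sum.cong)
      ultimately show ?thesis using main by linarith
    qed
  qed
  then show "dominates \<nu> (conjugate \<nu>)" using dominates_conjugate_iff[OF p\<nu>] by blast
qed

section \<open>Attaching \<open>\<lambda>\<close> and its conjugate to a square\<close>

lemma wide_seqD: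
  "wide_seq L \<Longrightarrow> (\<Sum>k\<in>{s + j..<N}. min (L k) j) \<le> (\<Sum>k\<in>{s..<s + j}. L k - j)"
  by (simp add: wide_seq_def)

lemma wide_seq_antimono: "wide_seq L \<Longrightarrow> i \<le> k \<Longrightarrow> L k \<le> L i"
  by (simp add: wide_seq_def antimono_def)

text \<open>The inequality at \<open>s = 0\<close>, \<open>j = 1\<close> weighs the first column
  below row 0 against row 0 without its first cell, so at most \<open>L 0\<close> rows are
  nonempty.\<close>

lemma wide_seq_zero:
  assumes "wide_seq L" "L 0 \<le> k"
  shows "L k = 0"
proof (rule ccontr)
  assume k: "L k \<noteq> 0"
  have "min (L r) 1 = 1" if "r \<le> k" for r
    using wide_seq_antimono[OF assms(1) that] k by simp
  then have "(\<Sum>r\<in>{0 + 1..<Suc k}. min (L r) 1) = k" by simp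
  moreover have "(\<Sum>r\<in>{0..<0 + 1}. L r - 1) = L 0 - 1" by simp
  ultimately have "k \<le> L 0 - 1" using wide_seqD[OF assms(1), where s = 0 and j = 1 and N = "Suc k"] by linarith
  then show False using assms(2) k wide_seq_antimono[OF assms(1), of 0 k] by simp
qed

text \<open>This is the inequality at \<open>(p, s)\<close> after adding to both sides the cells of
  the rows from \<open>p + s\<close> on outside the first \<open>s\<close> columns.\<close>

lemma wide_seq_tail_le:
  assumes "wide_seq L"
  shows "(\<Sum>k\<in>{p + s..<N}. L k) \<le> (\<Sum>k\<in>{p..<N}. L k - s)"
proof (cases "p + s \<le> N")
  case True
  have "(\<Sum>k\<in>{p + s..<N}. L k) = (\<Sum>k\<in>{p + s..<N}. min (L k) s) + (\<Sum>k\<in>{p + s..<N}. L k - s)"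
    by (auto simp: sum.distrib[symmetric] intro!: sum.cong)
  also have "\<dots> \<le> (\<Sum>k\<in>{p..<p + s}. L k - s) + (\<Sum>k\<in>{p + s..<N}. L k - s)"
    using wide_seqD[OF assms] by (intro add_right_mono)
  also have "\<dots> = (\<Sum>k\<in>{p..<N}. L k - s)"
    using True by (intro sum.atLeastLessThan_concat) auto
  finally show ?thesis .
qed simp

text \<open>Compares columns 0 to \<open>j - 1\<close> with columns \<open>s\<close> to
  \<open>s + j - 1\<close>. Rows of length at least \<open>s + j\<close> have \<open>j\<close> cells
  in both. The next \<open>j\<close> rows are granted \<open>s\<close> cells each; this also covers
  their cells outside the first \<open>j\<close> columns, which bound the remaining rows.\<close>

lemma wide_seq_columns_shift:
  assumes W: "wide_seq L"
  shows "(\<Sum>k<N. min (L k) j) \<le> s * j + (\<Sum>k<N. min (L k) (s + j) - s)"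
proof (cases "s = 0 \<or> j = 0")
  case False
  \<comment> \<open>\<open>a\<close> is the number of rows of length at least \<open>s + j\<close>; the inequality for \<open>(a, j)\<close> is used.\<close>
  define a where "a = (LEAST k. L k < s + j)"
  have "L (L 0) < s + j" using wide_seq_zero[OF W, of "L 0"] False by simp
  then have a: "L a < s + j" unfolding a_def by (rule LeastI)
  have before: "s + j \<le> L k" if "k < a" for k
    using not_less_Least[of k "\<lambda>k. L k < s + j"] that by (simp add: a_def)
  define K where "K = N + a + j"
  have split: "(\<Sum>k<K. f k) = (\<Sum>k<a. f k) + (\<Sum>k\<in>{a..<a + j}. f k) + (\<Sum>k\<in>{a + j..<K}. f k)"
    for f :: "nat \<Rightarrow> nat"
    unfolding lessThan_atLeast0 by (simp add: sum.atLeastLessThan_concat K_def)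
  have main: "(\<Sum>k<K. min (L k) j) \<le> s * j + (\<Sum>k<K. min (L k) (s + j) - s)"
  proof -
    have "(\<Sum>k<a. min (L k) j) \<le> (\<Sum>k<a. min (L k) (s + j) - s)"
      by (rule sum_mono) (use before in auto)
    moreover have "(\<Sum>k\<in>{a..<a + j}. min (L k) j + (L k - j))
        \<le> (\<Sum>k\<in>{a..<a + j}. s + (min (L k) (s + j) - s))"
    proof (rule sum_mono)
      fix k assume "k \<in> {a..<a + j}"
      then have "L k < s + j" using a wide_seq_antimono[OF W, of a k] by simp
      then show "min (L k) j + (L k - j) \<le> s + (min (L k) (s + j) - s)" by simp
    qed
    moreover have "(\<Sum>k\<in>{a + j..<K}. min (L k) j) \<le> (\<Sum>k\<in>{a..<a + j}. L k - j)"
      by (rule wide_seqD[OF W])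
    ultimately show ?thesis unfolding split by (simp add: sum.distrib mult.commute)
  qed
  \<comment> \<open>Rows from \<open>N\<close> on contribute at least as much to the left side of
    \<open>main\<close> as to its right side, so they can be removed.\<close>
  have "(\<Sum>k\<in>{N..<K}. min (L k) (s + j) - s) \<le> (\<Sum>k\<in>{N..<K}. min (L k) j)"
    by (rule sum_mono) auto
  moreover have "(\<Sum>k<K. f k) = (\<Sum>k<N. f k) + (\<Sum>k\<in>{N..<K}. f k)" for f :: "nat \<Rightarrow> nat"
    unfolding lessThan_atLeast0 by (simp add: sum.atLeastLessThan_concat K_def)
  ultimately show ?thesis using main by simp
qed auto

text \<open>Row lengths of \<open>\<mu>\<close>. Since a wide partition has at most \<open>m = L 0\<close> parts, the columns of
  \<open>\<lambda>\<close> can be counted in the rows below \<open>m\<close>.\<close>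

definition square_ext :: "(nat \<Rightarrow> nat) \<Rightarrow> nat \<Rightarrow> nat" where
  "square_ext L k =
     (if k < 2 * L 0 then 2 * L 0 + card {r\<in>{..<L 0}. k < L r} else L (k - 2 * L 0))"

lemma wide_seq_square_ext:
  assumes W: "wide_seq L"
  shows "wide_seq (square_ext L)"
  unfolding wide_seq_def
proof (intro conjI allI)
  define m where "m = L 0"
  define C where "C k = card {r\<in>{..<m}. k < L r}" for k
  define M where "M = square_ext L"
  have M_low: "M k = 2 * m + C k" if "k < 2 * m" for k
    using that by (simp add: M_def square_ext_def m_def C_def)
  have M_shift: "M (k + 2 * m) = L k" for k
    by (simp add: M_def square_ext_def m_def)
  have L_le: "L k \<le> m" for k using wide_seq_antimono[OF W, of 0 k] by (simp add: m_def)
  have L_zero: "L k = 0" if "m \<le> k" for k using wide_seq_zero[OF W] that by (simp add: m_def)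
  have sum_C: "(\<Sum>k\<in>{s..<t}. C k) = (\<Sum>r<m. min (L r) t - s)" for s t
    unfolding C_def by (rule sum_card_levels) simp
  have sum_M_shift: "(\<Sum>k\<in>{x + 2 * m..<y + 2 * m}. f (M k)) = (\<Sum>k\<in>{x..<y}. f (L k))"
    for x y and f :: "nat \<Rightarrow> nat"
    by (simp add: sum.shift_bounds_nat_ivl M_shift)
  have sum_L_le: "(\<Sum>k\<in>{x..<y}. L k) \<le> (y - x) * m" for x y
    using sum_bounded_above[of "{x..<y}" L m] L_le by simp
  have L_trunc: "(\<Sum>k\<in>{x..<y}. f (L k)) \<le> (\<Sum>k\<in>{x..<m}. f (L k))"
    if "f 0 = 0" for x y and f :: "nat \<Rightarrow> nat"
  proof -
    have "(\<Sum>k\<in>{x..<y}. f (L k)) = (\<Sum>k\<in>{x..<min y m}. f (L k))"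
      by (rule sum.mono_neutral_right) (auto simp: L_zero that)
    also have "\<dots> \<le> (\<Sum>k\<in>{x..<m}. f (L k))" by (rule sum_mono2) auto
    finally show ?thesis .
  qed
  show "antimono (square_ext L)"
  proof (rule antimonoI, fold M_def)
    fix x y :: nat assume "x \<le> y"
    have "C y \<le> C x" unfolding C_def by (rule card_mono) (use \<open>x \<le> y\<close> in auto)
    moreover have "M y \<le> m" if "2 * m \<le> y"
      using M_shift[of "y - 2 * m"] L_le[of "y - 2 * m"] that by simp
    moreover have "M y \<le> M x" if "2 * m \<le> x"
      using M_shift[of "y - 2 * m"] M_shift[of "x - 2 * m"] that \<open>x \<le> y\<close>
        wide_seq_antimono[OF W, of "x - 2 * m" "y - 2 * m"] by simp
    ultimately show "M y \<le> M x" using M_low[of x] M_low[of y] by fastforce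
  qed
  fix s j N
  show "(\<Sum>k\<in>{s + j..<N}. min (square_ext L k) j) \<le> (\<Sum>k\<in>{s..<s + j}. square_ext L k - j)"
  proof (fold M_def)
    have big_tail: "(\<Sum>k\<in>{r + 2 * m..<N}. min (M k) j) \<le> (\<Sum>k\<in>{r..<m}. min (L k) j)" for r
    proof -
      have "(\<Sum>k\<in>{r + 2 * m..<N}. min (M k) j) \<le> (\<Sum>k\<in>{r + 2 * m..<N + 2 * m}. min (M k) j)"
        by (rule sum_mono2) auto
      also have "\<dots> \<le> (\<Sum>k\<in>{r..<m}. min (L k) j)"
        unfolding sum_M_shift[of "\<lambda>x. min x j"] by (rule L_trunc) simp
      finally show ?thesis .
    qed
    consider (wide) "2 * m \<le> j" | (low) "2 * m \<le> s"
      | (mid) "s < 2 * m" "j < 2 * m" "2 * m \<le> s + j" | (high) "s + j < 2 * m"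
      by linarith
    then show "(\<Sum>k\<in>{s + j..<N}. min (M k) j) \<le> (\<Sum>k\<in>{s..<s + j}. M k - j)"
    proof cases
      case wide
      \<comment> \<open>The rows on the left are rows of \<open>L\<close> from \<open>p + s\<close>
        on. \<open>wide_seq_tail_le\<close> bounds them by cells outside the first \<open>s\<close>
        columns, which are recounted by columns as cells of the attached conjugate.\<close>
      define p where "p = j - 2 * m"
      have j: "j = p + 2 * m" using wide by (simp add: p_def)
      have "(\<Sum>k\<in>{s + j..<N}. min (M k) j) \<le> (\<Sum>k\<in>{p + s..<m}. min (L k) j)"
        using big_tail[of "p + s"] by (simp add: j ac_simps)
      also have "\<dots> \<le> (\<Sum>k\<in>{p + s..<m}. L k)" by (rule sum_mono) simp
      also have "\<dots> \<le> (\<Sum>k\<in>{p..<m}. L k - s)" by (rule wide_seq_tail_le[OF W])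
      also have "\<dots> = (\<Sum>k\<in>{p..<m}. min (L k) m - s)"
        by (rule sum.cong) (auto simp: L_le min_absorb1)
      also have "\<dots> = (\<Sum>k\<in>{s..<m}. card {r\<in>{p..<m}. k < L r})"
        by (rule sum_card_levels[symmetric]) simp
      also have "\<dots> \<le> (\<Sum>k\<in>{s..<m}. M k - j)"
      proof (rule sum_mono)
        fix k assume k: "k \<in> {s..<m}"
        \<comment> \<open>If some row from \<open>p\<close> on is longer than \<open>k\<close>, so
          are the \<open>p\<close> rows before it, and \<open>C k\<close> counts these too.\<close>
        have "card {r\<in>{p..<m}. k < L r} + p \<le> C k" if ne: "{r\<in>{p..<m}. k < L r} \<noteq> {}"
        proof -
          from ne obtain r0 where r0: "p \<le> r0" "r0 < m" "k < L r0" by auto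
          have "k < L r" if "r < p" for r
            using wide_seq_antimono[OF W, of r r0] that r0 by simp
          then have un: "{r\<in>{..<m}. k < L r} = {r\<in>{p..<m}. k < L r} \<union> {..<p}"
            using r0 by auto
          have "C k = card {r\<in>{p..<m}. k < L r} + card {..<p}"
            unfolding C_def un by (rule card_Un_disjoint) auto
          then show ?thesis by simp
        qed
        then have "card {r\<in>{p..<m}. k < L r} \<le> C k - p" 
          by (cases "{r\<in>{p..<m}. k < L r} = {}") (fastforce simp only: card.empty)+
        then show "card {r\<in>{p..<m}. k < L r} \<le> M k - j"
          using k M_low[of k] by (simp add: j)
      qed
      also have "\<dots> \<le> (\<Sum>k\<in>{s..<s + j}. M k - j)" by (rule sum_mono2) (auto simp: j)
      finally show ?thesis .
    next
      case low
      define r where "r = s - 2 * m"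
      have s: "s = r + 2 * m" using low by (simp add: r_def)
      have "(\<Sum>k\<in>{s + j..<N}. min (M k) j) \<le> (\<Sum>k\<in>{r + j..<m}. min (L k) j)"
        using big_tail[of "r + j"] by (simp add: s ac_simps)
      also have "\<dots> \<le> (\<Sum>k\<in>{r..<r + j}. L k - j)" by (rule wide_seqD[OF W])
      also have "\<dots> = (\<Sum>k\<in>{s..<s + j}. M k - j)"
        using sum_M_shift[of "\<lambda>x. x - j" r "r + j"] by (simp add: s ac_simps)
      finally show ?thesis .
    next
      case mid
      \<comment> \<open>Among the \<open>j\<close> rows from \<open>s\<close> on, \<open>u\<close>
        meet the square, each with \<open>v\<close> square cells outside the first \<open>j\<close>
        columns; the other \<open>r\<close> are the first rows of \<open>L\<close>.\<close>
      define u v r where "u = 2 * m - s" and "v = 2 * m - j" and "r = s + j - 2 * m"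
      have r: "s + j = r + 2 * m" using mid by (simp add: r_def)
      have B: "(\<Sum>k\<in>{s + j..<N}. min (M k) j) \<le> (\<Sum>k\<in>{r..<m}. min (L k) j)"
        using big_tail[of r] by (simp add: r)
      have B': "(\<Sum>k\<in>{r..<m}. min (L k) j) \<le> (\<Sum>k\<in>{r..<m}. L k)" by (rule sum_mono) simp
      have "(\<Sum>k\<in>{s..<s + j}. M k - j) = (\<Sum>k\<in>{s..<2 * m}. M k - j) + (\<Sum>k\<in>{2 * m..<s + j}. M k - j)"
        using mid by (intro sum.atLeastLessThan_concat[symmetric]) auto
      moreover have "(\<Sum>k\<in>{s..<2 * m}. M k - j) = (\<Sum>k\<in>{s..<2 * m}. v + C k)"
        using mid by (intro sum.cong) (auto simp: M_low v_def)
      moreover have "(\<Sum>k\<in>{2 * m..<s + j}. M k - j) = (\<Sum>k\<in>{0..<r}. L k - j)"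
        using sum_M_shift[of "\<lambda>x. x - j" 0 r] by (simp add: r)
      ultimately have A: "(\<Sum>k\<in>{s..<s + j}. M k - j)
          = u * v + (\<Sum>k\<in>{s..<2 * m}. C k) + (\<Sum>k\<in>{0..<r}. L k - j)"
        by (simp add: sum.distrib u_def)
      consider (a) "m \<le> j" "m \<le> s" | (b) "s < m" | (c) "j < m" by linarith
      then show ?thesis
      proof cases
        case a
        \<comment> \<open>For \<open>r \<le> m\<close>, \<open>m - r = u + v - m\<close>, so the
          claim is \<open>(m - u) * (m - v) \<ge> 0\<close>; integers avoid truncated
          subtraction.\<close>
        have "(m - r) * m \<le> u * v"
        proof (cases "r \<le> m")
          case True
          have mr: "int (m - r) = int u + int v - int m"
            using True mid a by (simp add: u_def v_def r_def)
          have "0 \<le> (int m - int u) * (int m - int v)"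
            using a by (intro mult_nonneg_nonneg) (auto simp: u_def v_def)
          then have "int (m - r) * int m \<le> int u * int v" unfolding mr by (simp add: algebra_simps)
          then show ?thesis by (simp flip: of_nat_mult)
        qed simp
        then show ?thesis using A B B' sum_L_le[of r m] by linarith
      next
        case b
        \<comment> \<open>Rows \<open>r\<close> to \<open>s - 1\<close> of \<open>L\<close> are paid
          by the \<open>u * v\<close> square cells, as \<open>m \<le> u\<close>; the later ones by
          the conjugate through \<open>wide_seq_tail_le\<close>.\<close>
        have rs: "r \<le> s" "s - r = v" using mid by (auto simp: r_def v_def)
        have "(\<Sum>k\<in>{r..<m}. L k) = (\<Sum>k\<in>{r..<s}. L k) + (\<Sum>k\<in>{s..<m}. L k)"
          using rs b by (intro sum.atLeastLessThan_concat[symmetric]) auto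
        moreover have "(\<Sum>k\<in>{r..<s}. L k) \<le> v * m" using sum_L_le[of r s] rs by simp
        moreover have "v * m \<le> u * v"
        proof -
          have "m \<le> u" using b by (simp add: u_def)
          then show ?thesis by (simp add: mult.commute)
        qed
        moreover have "(\<Sum>k\<in>{s..<m}. L k) \<le> (\<Sum>k<m. L k - s)"
          using wide_seq_tail_le[OF W, of 0 s m] by (simp add: lessThan_atLeast0)
        moreover have "(\<Sum>k<m. L k - s) = (\<Sum>k\<in>{s..<2 * m}. C k)"
        proof -
          have "min (L k) (2 * m) = L k" for k using L_le[of k] by simp
          then show ?thesis by (simp add: sum_C)
        qed
        ultimately show ?thesis using A B B' by linarith
      next
        case c
        \<comment> \<open>The inequality at \<open>(0, j)\<close> covers the rows of
          \<open>L\<close> from \<open>j\<close> on. Rows \<open>r\<close> to \<open>j - 1\<close>,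
          with the cells it charges to them, are paid by the square, as
          \<open>m \<le> v\<close>.\<close>
        have rj: "r \<le> j" "j - r = u" using mid by (auto simp: r_def u_def)
        have "(\<Sum>k\<in>{r..<m}. min (L k) j)
            = (\<Sum>k\<in>{r..<j}. min (L k) j) + (\<Sum>k\<in>{j..<m}. min (L k) j)"
          using rj c by (intro sum.atLeastLessThan_concat[symmetric]) auto
        moreover have "(\<Sum>k\<in>{j..<m}. min (L k) j) \<le> (\<Sum>k\<in>{0..<j}. L k - j)"
          using wide_seqD[OF W, where s = 0 and j = j and N = m] by simp
        moreover have "(\<Sum>k\<in>{0..<j}. L k - j) = (\<Sum>k\<in>{0..<r}. L k - j) + (\<Sum>k\<in>{r..<j}. L k - j)"
          using rj by (intro sum.atLeastLessThan_concat[symmetric]) auto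
        moreover have "(\<Sum>k\<in>{r..<j}. min (L k) j) + (\<Sum>k\<in>{r..<j}. L k - j) = (\<Sum>k\<in>{r..<j}. L k)"
          by (auto simp: sum.distrib[symmetric] intro!: sum.cong)
        moreover have "(\<Sum>k\<in>{r..<j}. L k) \<le> u * m" using sum_L_le[of r j] rj by simp
        moreover have "u * m \<le> u * v"
        proof -
          have "m \<le> v" using c by (simp add: v_def)
          then show ?thesis by simp
        qed
        ultimately show ?thesis using A B by linarith
      qed
    next
      case high
      \<comment> \<open>Of the \<open>j * v\<close> square cells on the right,
        \<open>(v - s) * j\<close> balance the square rows below; the other \<open>s * j\<close> are
        the allowance in \<open>wide_seq_columns_shift\<close>.\<close>
      define v where "v = 2 * m - j"
      have "(\<Sum>k\<in>{s + j..<N}. min (M k) j) \<le> (\<Sum>k\<in>{s + j..<2 * m + N}. min (M k) j)"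
        by (rule sum_mono2) auto
      also have "\<dots> = (\<Sum>k\<in>{s + j..<2 * m}. min (M k) j) + (\<Sum>k\<in>{2 * m..<2 * m + N}. min (M k) j)"
        using high by (intro sum.atLeastLessThan_concat[symmetric]) auto
      also have "(\<Sum>k\<in>{s + j..<2 * m}. min (M k) j) = (\<Sum>k\<in>{s + j..<2 * m}. j)"
        using high by (intro sum.cong) (auto simp: M_low)
      also have "\<dots> = (v - s) * j" by (simp add: v_def add.commute)
      also have "(\<Sum>k\<in>{2 * m..<2 * m + N}. min (M k) j) \<le> (\<Sum>k<m. min (L k) j)"
        using sum_M_shift[of "\<lambda>x. min x j" 0 N] L_trunc[of "\<lambda>x. min x j" 0 N]
        by (simp add: lessThan_atLeast0 add.commute)
      also have "(\<Sum>k<m. min (L k) j) \<le> s * j + (\<Sum>k<m. min (L k) (s + j) - s)"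
        by (rule wide_seq_columns_shift[OF W])
      also have "(\<Sum>k<m. min (L k) (s + j) - s) = (\<Sum>k\<in>{s..<s + j}. C k)" by (simp add: sum_C)
      also have "(v - s) * j + (s * j + (\<Sum>k\<in>{s..<s + j}. C k)) = j * v + (\<Sum>k\<in>{s..<s + j}. C k)"
      proof -
        have "v = (v - s) + s" using high by (simp add: v_def)
        then have "v * j = (v - s) * j + s * j" by (metis add_mult_distrib)
        then show ?thesis by (simp add: mult.commute)
      qed
      also have "\<dots> = (\<Sum>k\<in>{s..<s + j}. v + C k)" by (simp add: sum.distrib)
      also have "\<dots> = (\<Sum>k\<in>{s..<s + j}. M k - j)"
        using high by (intro sum.cong) (auto simp: M_low v_def)
      finally show ?thesis by simp
    qed
  qed
qed

section \<open>Identification of the rows of \<open>mu\<close>\<close>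

lemma is_partition_if_antimono_row:
  assumes "antimono (row \<alpha>)" "0 \<notin> set \<alpha>"
  shows "is_partition \<alpha>"
  unfolding is_partition_def sorted_wrt_iff_nth_less
proof (intro conjI allI impI ballI)
  fix i k assume "i < k" "k < length \<alpha>"
  then show "\<alpha> ! k \<le> \<alpha> ! i" using antimonoD[OF assms(1), of i k] by (simp add: row_eq)
next
  fix x assume "x \<in> set \<alpha>"
  then show "0 < x" using assms(2) by (metis gr0I)
qed

theorem theorem6:
  fixes lam mu :: "nat list" and m n :: nat
  assumes "wide lam"
    and "length lam = n"
    and "m = part lam 1"
    and "mu = map (\<lambda>j. 2 * m + part (conjugate lam) j) [1..<m + 1]
           @ replicate m (2 * m)
           @ map (part lam) [1..<n + 1]"
  shows "wide mu"
proof -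
  have part: "is_partition lam" using assms(1) by (simp add: wide_def)
  have W: "wide_seq (row lam)" using assms(1) by (rule wide_seq_row_if_wide)
  have m: "m = row lam 0" using assms(3) by (simp add: row_def)
  \<comment> \<open>The conjugate counts rows below \<open>length lam\<close>,
    \<open>square_ext\<close> rows below \<open>m\<close>; rows outside either range are
    empty.\<close>
  have levels: "row (conjugate lam) k = card {r\<in>{..<m}. k < row lam r}" for k
  proof -
    have "{r\<in>{..<length lam}. k < row lam r} = {r\<in>{..<m}. k < row lam r}"
    proof -
      have "row lam r = 0" if "\<not> r < m" for r using wide_seq_zero[OF W] m that by simp
      then have "r < m" if "k < row lam r" for r using that by fastforce
      moreover have "r < length lam" if "k < row lam r" for r
        using that by (auto simp: row_eq split: if_splits)
      ultimately show ?thesis by auto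
    qed
    then show ?thesis by (simp add: row_conjugate[OF part])
  qed
  \<comment> \<open>Columns of \<open>lam\<close> from \<open>m\<close> on are empty, so rows
    \<open>m\<close> to \<open>2 * m - 1\<close> of \<open>square_ext\<close> have length exactly
    \<open>2 * m\<close>, as in the middle block of \<open>mu\<close>.\<close>
  have no_level: "card {r\<in>{..<m}. k < row lam r} = 0" if "m \<le> k" for k
    using wide_seq_antimono[OF W, of 0] that m by (force simp: not_less dest: le_trans)
  have "row mu = square_ext (row lam)"
  proof
    fix k
    consider "k < m" | "m \<le> k" "k < 2 * m" | "2 * m \<le> k" by linarith
    then show "row mu k = square_ext (row lam) k"
    proof cases
      case 1
      then have "row mu k = 2 * m + row (conjugate lam) k"
        by (subst row_eq) (simp add: assms(4) nth_append row_def del: upt_Suc)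
      then show ?thesis using 1 levels by (simp add: square_ext_def m)
    next
      case 2
      then have "row mu k = 2 * m"
        by (subst row_eq) (auto simp: assms(4) nth_append simp del: upt_Suc)
      then show ?thesis using 2 no_level[of k] by (simp add: square_ext_def m)
    next
      case 3
      then have "row mu k = row lam (k - 2 * m)"
        using assms(2)
        by (subst row_eq) (auto simp: assms(4) nth_append row_def part_def mult_2[symmetric] simp del: upt_Suc)
      then show ?thesis using 3 by (simp add: square_ext_def m)
    qed
  qed
  then have seq: "wide_seq (row mu)" using wide_seq_square_ext[OF W] by simp
  have "part lam x \<noteq> 0" if "1 \<le> x" "x < n + 1" for x
    using part that assms(2) by (auto simp: is_partition_def part_def)
  then have "0 \<notin> set mu"
    unfolding assms(4) by (fastforce simp del: upt_Suc)
  then have "is_partition mu"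
    using seq is_partition_if_antimono_row by (simp add: wide_seq_def)
  then show ?thesis using seq by (rule wide_if_wide_seq_row)
qed

end
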